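(* Let $n,m\ge1$, let $F,F',F'':\mathbf{SVect}^n\to\mathbf{SVect}^m$ be $\mathbb C$-linear functors with rank matrices $(R^F_{ij})$, $(R^{F'}_{ij})$, $(R^{F''}_{ij})$, and let $\tau:F\Rightarrow F'$ and $\tau':F'\Rightarrow F''$ be natural transformations with vertical composite $\tau'\cdot\tau:F\Rightarrow F''$. Let $1\le i\le m$ and $1\le j\le n$. If $R^{F''}_{ij},R^{F'}_{ij},R^F_{ij}\ne0$, then $$\mathbf T(\tau'\cdot\tau)_{ij}=\mathbf T(\tau')_{ij}\,\mathbf T(\tau)_{ij},$$ the usual matrix product. Otherwise, $\mathbf T(\tau'\cdot\tau)_{ij}$ is either empty (when $R^F_{ij}=0$ or $R^{F''}_{ij}=0$) or the $R^{F''}_{ij}\times R^F_{ij}$ zero matrix (when $R^{F'}_{ij}=0$ and $R^F_{ij},R^{F''}_{ij}\ne0$).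
   Context: $\mathbf{SVect}$ is the full subcategory of the category of finite dimensional complex vector spaces with objects $\mathbb C^a$, $a\ge0$; $\mathbf{SVect}^n$ is its $n$-fold product. A functor is $\mathbb C$-linear if it is $\mathbb C$-linear on hom spaces. A functor $F:\mathbf{SVect}^n\to\mathbf{SVect}^m$ has components $F_1,\dots,F_m:\mathbf{SVect}^n\to\mathbf{SVect}$. $\mathbb C(j,n)=(0,\dots,0,\mathbb C,0,\dots,0)$ ($\mathbb C$ in position $j$) in $\mathbf{SVect}^n$. The rank matrix of $F$ is the $m\times n$ matrix with entries $R^F_{ij}=\dim F_i(\mathbb C(j,n))$. For $\tau:F\Rightarrow F'$, the component $\tau_{\mathbb C(j,n)}$ is an $m$-tuple of linear maps $\Phi(\tau)_{ij}:\mathbb C^{R^F_{ij}}\to\mathbb C^{R^{F'}_{ij}}$, $i=1,\dots,m$. The matrix $\mathbf T(\tau)$ of $\tau$ is the $m\times n$ matrix whose $(i,j)$-entry is the matrix of $\Phi(\tau)_{ij}$ in canonical bases (empty if $R^F_{ij}=0$ or $R^{F'}_{ij}=0$). *)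

theory Defs
  imports "Jordan_Normal_Form.VS_Connect" "HOL-Library.FuncSet"
begin

section \<open>Categories with linear structure on the hom spaces\<close>

text \<open>Homs are indexed by source and target and need not be disjoint, so composition, the linear
  operations and the action of a functor on arrows take the objects as explicit arguments;
  \<open>Comp C X Y Z g f\<close> is \<open>g\<close> after \<open>f\<close> for \<open>f : X \<rightarrow> Y\<close> and \<open>g : Y \<rightarrow> Z\<close>.\<close>

record ('o, 'a) lcat =
  Ob :: "'o set"
  Hom :: "'o \<Rightarrow> 'o \<Rightarrow> 'a set"
  Idt :: "'o \<Rightarrow> 'a"
  Comp :: "'o \<Rightarrow> 'o \<Rightarrow> 'o \<Rightarrow> 'a \<Rightarrow> 'a \<Rightarrow> 'a"
  Add :: "'o \<Rightarrow> 'o \<Rightarrow> 'a \<Rightarrow> 'a \<Rightarrow> 'a"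
  Scale :: "'o \<Rightarrow> 'o \<Rightarrow> complex \<Rightarrow> 'a \<Rightarrow> 'a"

definition is_category :: "('o, 'a) lcat \<Rightarrow> bool" where
  "is_category C \<longleftrightarrow>
     (\<forall>X\<in>Ob C. Idt C X \<in> Hom C X X) \<and>
     (\<forall>X\<in>Ob C. \<forall>Y\<in>Ob C. \<forall>Z\<in>Ob C. \<forall>f\<in>Hom C X Y. \<forall>g\<in>Hom C Y Z. Comp C X Y Z g f \<in> Hom C X Z) \<and>
     (\<forall>X\<in>Ob C. \<forall>Y\<in>Ob C. \<forall>f\<in>Hom C X Y.
        Comp C X X Y f (Idt C X) = f \<and> Comp C X Y Y (Idt C Y) f = f) \<and>
     (\<forall>W\<in>Ob C. \<forall>X\<in>Ob C. \<forall>Y\<in>Ob C. \<forall>Z\<in>Ob C. \<forall>f\<in>Hom C W X. \<forall>g\<in>Hom C X Y. \<forall>h\<in>Hom C Y Z.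
        Comp C W Y Z h (Comp C W X Y g f) = Comp C W X Z (Comp C X Y Z h g) f)"

record ('o, 'a, 'p, 'b) func =
  obj :: "'o \<Rightarrow> 'p"
  arr :: "'o \<Rightarrow> 'o \<Rightarrow> 'a \<Rightarrow> 'b"

definition is_functor :: "('o, 'a) lcat \<Rightarrow> ('p, 'b) lcat \<Rightarrow> ('o, 'a, 'p, 'b) func \<Rightarrow> bool" where
  "is_functor C D F \<longleftrightarrow>
     (\<forall>X\<in>Ob C. obj F X \<in> Ob D) \<and>
     (\<forall>X\<in>Ob C. \<forall>Y\<in>Ob C. \<forall>f\<in>Hom C X Y. arr F X Y f \<in> Hom D (obj F X) (obj F Y)) \<and>
     (\<forall>X\<in>Ob C. arr F X X (Idt C X) = Idt D (obj F X)) \<and>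
     (\<forall>X\<in>Ob C. \<forall>Y\<in>Ob C. \<forall>Z\<in>Ob C. \<forall>f\<in>Hom C X Y. \<forall>g\<in>Hom C Y Z.
        arr F X Z (Comp C X Y Z g f) =
        Comp D (obj F X) (obj F Y) (obj F Z) (arr F Y Z g) (arr F X Y f))"

definition linear_functor :: "('o, 'a) lcat \<Rightarrow> ('p, 'b) lcat \<Rightarrow> ('o, 'a, 'p, 'b) func \<Rightarrow> bool" where
  "linear_functor C D F \<longleftrightarrow> is_functor C D F \<and>
     (\<forall>X\<in>Ob C. \<forall>Y\<in>Ob C. \<forall>f\<in>Hom C X Y. \<forall>g\<in>Hom C X Y.
        arr F X Y (Add C X Y f g) = Add D (obj F X) (obj F Y) (arr F X Y f) (arr F X Y g)) \<and>
     (\<forall>X\<in>Ob C. \<forall>Y\<in>Ob C. \<forall>c. \<forall>f\<in>Hom C X Y.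
        arr F X Y (Scale C X Y c f) = Scale D (obj F X) (obj F Y) c (arr F X Y f))"

definition nat_trans :: "('o, 'a) lcat \<Rightarrow> ('p, 'b) lcat \<Rightarrow>
    ('o, 'a, 'p, 'b) func \<Rightarrow> ('o, 'a, 'p, 'b) func \<Rightarrow> ('o \<Rightarrow> 'b) \<Rightarrow> bool" where
  "nat_trans C D F G \<tau> \<longleftrightarrow>
     (\<forall>X\<in>Ob C. \<tau> X \<in> Hom D (obj F X) (obj G X)) \<and>
     (\<forall>X\<in>Ob C. \<forall>Y\<in>Ob C. \<forall>f\<in>Hom C X Y.
        Comp D (obj F X) (obj G X) (obj G Y) (arr G X Y f) (\<tau> X) =
        Comp D (obj F X) (obj F Y) (obj G Y) (\<tau> Y) (arr F X Y f))"

text \<open>\<open>vcomp D F F' F'' \<tau>' \<tau>\<close> is the vertical composite of \<open>\<tau> : F \<Rightarrow> F'\<close> and \<open>\<tau>' : F' \<Rightarrow> F''\<close>.\<close>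

definition vcomp :: "('p, 'b) lcat \<Rightarrow> ('o, 'a, 'p, 'b) func \<Rightarrow> ('o, 'a, 'p, 'b) func \<Rightarrow>
    ('o, 'a, 'p, 'b) func \<Rightarrow> ('o \<Rightarrow> 'b) \<Rightarrow> ('o \<Rightarrow> 'b) \<Rightarrow> 'o \<Rightarrow> 'b" where
  "vcomp D F F' F'' \<tau>' \<tau> = (\<lambda>X. Comp D (obj F X) (obj F' X) (obj F'' X) (\<tau>' X) (\<tau> X))"

lemma nat_trans_vcomp:
  assumes D: "is_category D"
    and F: "is_functor C D F" "is_functor C D F'" "is_functor C D F''"
    and \<tau>: "nat_trans C D F F' \<tau>" "nat_trans C D F' F'' \<tau>'"
  shows "nat_trans C D F F'' (vcomp D F F' F'' \<tau>' \<tau>)"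
proof -
  have ob: "obj F X \<in> Ob D" "obj F' X \<in> Ob D" "obj F'' X \<in> Ob D" if "X \<in> Ob C" for X
    using F that by (auto simp: is_functor_def)
  have ar: "arr F X Y f \<in> Hom D (obj F X) (obj F Y)" "arr F' X Y f \<in> Hom D (obj F' X) (obj F' Y)"
    "arr F'' X Y f \<in> Hom D (obj F'' X) (obj F'' Y)"
    if "X \<in> Ob C" "Y \<in> Ob C" "f \<in> Hom C X Y" for X Y f
    using F that by (auto simp: is_functor_def)
  have cl: "Comp D X Y Z g f \<in> Hom D X Z"
    if "X \<in> Ob D" "Y \<in> Ob D" "Z \<in> Ob D" "f \<in> Hom D X Y" "g \<in> Hom D Y Z" for X Y Z f g
    using D that unfolding is_category_def by blast
  have as: "Comp D W Y Z h (Comp D W X Y g f) = Comp D W X Z (Comp D X Y Z h g) f"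
    if "W \<in> Ob D" "X \<in> Ob D" "Y \<in> Ob D" "Z \<in> Ob D" "f \<in> Hom D W X" "g \<in> Hom D X Y" "h \<in> Hom D Y Z"
    for W X Y Z f g h
    using D that unfolding is_category_def by blast
  have t: "\<tau> X \<in> Hom D (obj F X) (obj F' X)" "\<tau>' X \<in> Hom D (obj F' X) (obj F'' X)" if "X \<in> Ob C" for X
    using \<tau> that by (auto simp: nat_trans_def)
  have n: "Comp D (obj F X) (obj F' X) (obj F' Y) (arr F' X Y f) (\<tau> X) =
        Comp D (obj F X) (obj F Y) (obj F' Y) (\<tau> Y) (arr F X Y f)"
     "Comp D (obj F' X) (obj F'' X) (obj F'' Y) (arr F'' X Y f) (\<tau>' X) =
        Comp D (obj F' X) (obj F' Y) (obj F'' Y) (\<tau>' Y) (arr F' X Y f)"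
    if "X \<in> Ob C" "Y \<in> Ob C" "f \<in> Hom C X Y" for X Y f
    using \<tau> that by (auto simp: nat_trans_def)
  show ?thesis
    unfolding nat_trans_def vcomp_def
  proof (intro conjI ballI)
    fix X assume X: "X \<in> Ob C"
    then show "Comp D (obj F X) (obj F' X) (obj F'' X) (\<tau>' X) (\<tau> X) \<in> Hom D (obj F X) (obj F'' X)"
      by (intro cl ob t)
  next
    fix X Y f assume a: "X \<in> Ob C" "Y \<in> Ob C" "f \<in> Hom C X Y"
    note facts = ob[OF a(1)] ob[OF a(2)] ar[OF a] t[OF a(1)] t[OF a(2)]
    show "Comp D (obj F X) (obj F'' X) (obj F'' Y) (arr F'' X Y f)
          (Comp D (obj F X) (obj F' X) (obj F'' X) (\<tau>' X) (\<tau> X)) =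
        Comp D (obj F X) (obj F Y) (obj F'' Y)
          (Comp D (obj F Y) (obj F' Y) (obj F'' Y) (\<tau>' Y) (\<tau> Y)) (arr F X Y f)"
      using facts n[OF a] by (metis as)
  qed
qed

section \<open>Finite powers of a category\<close>

text \<open>Tuples indexed by \<open>{..<n}\<close>; components are numbered from \<open>0\<close>, as are the entries of
  matrices in the library.\<close>

definition power_cat :: "('o, 'a) lcat \<Rightarrow> nat \<Rightarrow> (nat \<Rightarrow> 'o, nat \<Rightarrow> 'a) lcat" where
  "power_cat C n = \<lparr>
     Ob = ({..<n} \<rightarrow>\<^sub>E Ob C),
     Hom = (\<lambda>X Y. \<Pi>\<^sub>E k\<in>{..<n}. Hom C (X k) (Y k)),
     Idt = (\<lambda>X. \<lambda>k\<in>{..<n}. Idt C (X k)),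
     Comp = (\<lambda>X Y Z g f. \<lambda>k\<in>{..<n}. Comp C (X k) (Y k) (Z k) (g k) (f k)),
     Add = (\<lambda>X Y f g. \<lambda>k\<in>{..<n}. Add C (X k) (Y k) (f k) (g k)),
     Scale = (\<lambda>X Y c f. \<lambda>k\<in>{..<n}. Scale C (X k) (Y k) c (f k))\<rparr>"

lemma is_category_power_cat:
  assumes "is_category C"
  shows "is_category (power_cat C n)"
proof -
  have mem: "X k \<in> Ob C" if "X \<in> {..<n} \<rightarrow>\<^sub>E Ob C" "k < n" for X k
    using that by (auto simp: PiE_iff)
  show ?thesis
    using assms unfolding is_category_def power_cat_def
    by (intro conjI ballI; simp add: PiE_iff; intro ext; simp add: extensional_def)
qed

text \<open>The \<open>i\<close>-th component \<open>C \<rightarrow> D\<close> of a functor from \<open>C\<close> to a power of \<open>D\<close>.\<close>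

definition component :: "('o, 'a, nat \<Rightarrow> 'p, nat \<Rightarrow> 'b) func \<Rightarrow> nat \<Rightarrow> ('o, 'a, 'p, 'b) func" where
  "component F i = \<lparr>obj = (\<lambda>X. obj F X i), arr = (\<lambda>X Y f. arr F X Y f i)\<rparr>"

section \<open>The category SVect\<close>

abbreviation Cspace :: "nat \<Rightarrow> (complex, complex vec) module" where
  "Cspace a \<equiv> module_vec TYPE(complex) a"

text \<open>The object \<open>\<complex>\<^sup>a\<close> is represented by \<open>a\<close>. A linear map is a function on
  \<open>carrier_vec a\<close>, made \<open>undefined\<close> elsewhere so that equality of maps is equality in HOL.\<close>

definition SVect :: "(nat, complex vec \<Rightarrow> complex vec) lcat" where
  "SVect = \<lparr>
     Ob = UNIV,
     Hom = (\<lambda>a b. {f. linear_map class_ring (Cspace a) (Cspace b) f \<and> f \<in> extensional (carrier_vec a)}),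
     Idt = (\<lambda>a. \<lambda>v\<in>carrier_vec a. v),
     Comp = (\<lambda>a b c g f. compose (carrier_vec a) g f),
     Add = (\<lambda>a b f g. \<lambda>v\<in>carrier_vec a. f v + g v),
     Scale = (\<lambda>a b c f. \<lambda>v\<in>carrier_vec a. c \<cdot>\<^sub>v f v)\<rparr>"

abbreviation SVectn :: "nat \<Rightarrow> (nat \<Rightarrow> nat, nat \<Rightarrow> complex vec \<Rightarrow> complex vec) lcat" where
  "SVectn n \<equiv> power_cat SVect n"

type_synonym SVect_functor =
  "(nat \<Rightarrow> nat, nat \<Rightarrow> complex vec \<Rightarrow> complex vec, nat \<Rightarrow> nat, nat \<Rightarrow> complex vec \<Rightarrow> complex vec) func"

type_synonym SVect_trans = "(nat \<Rightarrow> nat) \<Rightarrow> nat \<Rightarrow> complex vec \<Rightarrow> complex vec"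

lemma linear_map_Cspace_iff:
  "linear_map class_ring (Cspace a) (Cspace b) f \<longleftrightarrow>
     f \<in> carrier_vec a \<rightarrow> carrier_vec b \<and>
     (\<forall>v\<in>carrier_vec a. \<forall>w\<in>carrier_vec a. f (v + w) = f v + f w) \<and>
     (\<forall>c. \<forall>v\<in>carrier_vec a. f (c \<cdot>\<^sub>v v) = c \<cdot>\<^sub>v f v)"
proof -
  have "vectorspace class_ring (Cspace k)" for k
    by (rule vec_vs)
  moreover from this have "module class_ring (Cspace k)" for k
    by (simp add: vectorspace_def)
  ultimately show ?thesis
    by (auto simp: linear_map_def mod_hom_def mod_hom_axioms_def LinearCombinations.module_hom_def module_vec_simps)
qed

lemma is_category_SVect: "is_category SVect"
  unfolding is_category_def SVect_def
  by (auto simp: linear_map_Cspace_iff compose_def Pi_iff extensional_def fun_eq_iff)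

lemma dim_Cspace: "vectorspace.dim class_ring (Cspace a) = a"
  by (rule vec_space.dim_is_n)

section \<open>Rank matrices and matrices of natural transformations\<close>

text \<open>The object \<open>(0, \<dots>, 0, \<complex>, 0, \<dots>, 0)\<close> of \<open>SVectn n\<close> with \<open>\<complex>\<close> in position \<open>j\<close>.\<close>

definition Cj :: "nat \<Rightarrow> nat \<Rightarrow> nat \<Rightarrow> nat" where
  "Cj j n = (\<lambda>k\<in>{..<n}. if k = j then 1 else 0)"

definition rank_matrix :: "nat \<Rightarrow> nat \<Rightarrow> SVect_functor \<Rightarrow> nat mat" where
  "rank_matrix m n F =
     mat m n (\<lambda>(i, j). vectorspace.dim class_ring (Cspace (obj (component F i) (Cj j n))))"

definition canonical_matrix :: "nat \<Rightarrow> nat \<Rightarrow> (complex vec \<Rightarrow> complex vec) \<Rightarrow> complex mat" where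
  "canonical_matrix a b f = mat b a (\<lambda>(k, l). f (unit_vec a l) $ k)"

definition Phi :: "nat \<Rightarrow> SVect_trans \<Rightarrow> nat \<Rightarrow> nat \<Rightarrow> complex vec \<Rightarrow> complex vec" where
  "Phi n \<tau> i j = \<tau> (Cj j n) i"

text \<open>A matrix whose entries are matrices. If \<open>a\<close> or \<open>b\<close> is \<open>0\<close> then \<open>canonical_matrix a b f\<close>
  has no entries.\<close>

definition T_matrix ::
    "nat \<Rightarrow> nat \<Rightarrow> SVect_functor \<Rightarrow> SVect_functor \<Rightarrow> SVect_trans \<Rightarrow> complex mat mat" where
  "T_matrix m n F F' \<tau> = mat m n (\<lambda>(i, j).
     canonical_matrix (rank_matrix m n F $$ (i, j)) (rank_matrix m n F' $$ (i, j)) (Phi n \<tau> i j))"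

definition empty_mat :: "'a mat \<Rightarrow> bool" where
  "empty_mat A \<longleftrightarrow> dim_row A = 0 \<or> dim_col A = 0"

end

theory Submission
  imports Defs
begin

text \<open>Vertical composites are formed object by object, and composition in
  \<open>SVectn m\<close> coordinate by coordinate. Hence at \<open>Cj j n\<close> the
  \<open>i\<close>-th map of the composite is the composite of the linear maps
  \<open>Phi n \<tau> i j\<close> and \<open>Phi n \<tau>' i j\<close>, and its matrix is the
  product of theirs (\<open>canonical_matrix_Comp\<close>). The resulting identity
  \<open>T_matrix_vcomp\<close> covers rank 0 too, with matrices having no rows or no columns; the
  exceptional cases are then read off from the shape of the product and from the vanishing of an
  empty sum.\<close>

text \<open>Expand \<open>v\<close> in the canonical basis and use linearity; comparing coordinates
  keeps all sums in the complex numbers.\<close>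

lemma SVect_map_eq_canonical_matrix:
  assumes f: "f \<in> Hom SVect a b" and v: "v \<in> carrier_vec a"
  shows "f v = canonical_matrix a b f *\<^sub>v v"
proof -
  have closed: "f w \<in> carrier_vec b" if "w \<in> carrier_vec a" for w
    using f that by (auto simp: SVect_def linear_map_Cspace_iff)
  have add: "f (u + w) = f u + f w" if "u \<in> carrier_vec a" "w \<in> carrier_vec a" for u w
    using f that by (auto simp: SVect_def linear_map_Cspace_iff)
  have scale: "f (c \<cdot>\<^sub>v w) = c \<cdot>\<^sub>v f w" if "w \<in> carrier_vec a" for c w
    using f that by (auto simp: SVect_def linear_map_Cspace_iff)
  \<comment> \<open>\<open>trunc t\<close> is the partial sum of the first \<open>t\<close> terms of
    the basis expansion of \<open>v\<close>, so induction on \<open>t\<close> needs additivity for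
    two summands only.\<close>
  define trunc where "trunc t = vec a (\<lambda>l. if l < t then v $ l else 0)" for t
  have trunc_carrier: "trunc t \<in> carrier_vec a" for t
    by (simp add: trunc_def)
  have coord: "f (trunc t) $ k = (\<Sum>l<t. f (unit_vec a l) $ k * v $ l)"
    if "t \<le> a" "k < b" for t k
    using that
  proof (induction t)
    case 0
    \<comment> \<open>Writing the zero vector as a multiple by 0 lets homogeneity give that
      \<open>f\<close> maps it to zero.\<close>
    have "trunc 0 = 0 \<cdot>\<^sub>v 0\<^sub>v a"
      by (auto simp: trunc_def)
    then have "f (trunc 0) = 0 \<cdot>\<^sub>v f (0\<^sub>v a)"
      by (simp only: scale[OF zero_carrier_vec])
    then show ?case
      using 0 closed[of "0\<^sub>v a"] by simp
  next
    case (Suc t)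
    have "trunc (Suc t) = trunc t + v $ t \<cdot>\<^sub>v unit_vec a t"
      using Suc.prems by (intro eq_vecI) (auto simp: trunc_def unit_vec_def less_Suc_eq)
    then have "f (trunc (Suc t)) = f (trunc t) + v $ t \<cdot>\<^sub>v f (unit_vec a t)"
      by (simp add: add scale trunc_carrier)
    then show ?case
      using Suc closed[of "unit_vec a t"] closed[OF trunc_carrier] by simp
  qed
  have "trunc a = v"
    using v by (intro eq_vecI) (auto simp: trunc_def)
  then show ?thesis
    using coord[of a] closed[OF v] v
    by (intro eq_vecI)
      (auto simp: canonical_matrix_def scalar_prod_def atLeast0LessThan)
qed

text \<open>Column \<open>l\<close> of the left side is \<open>g\<close> applied to the image of the
  \<open>l\<close>-th unit vector under \<open>f\<close>. That image is column \<open>l\<close> of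
  the matrix of \<open>f\<close>, and \<open>g\<close> acts on it as its own matrix.\<close>

lemma canonical_matrix_Comp:
  assumes f: "f \<in> Hom SVect a b" and g: "g \<in> Hom SVect b c"
  shows "canonical_matrix a c (Comp SVect a b c g f) = canonical_matrix b c g * canonical_matrix a b f"
    (is "?L = ?R")
proof (rule eq_matI)
  fix k l
  assume "k < dim_row ?R" "l < dim_col ?R"
  then have k: "k < c" and l: "l < a"
    by (simp_all add: canonical_matrix_def)
  have closed: "f (unit_vec a l) \<in> carrier_vec b"
    using f by (auto simp: SVect_def linear_map_Cspace_iff)
  have "?L $$ (k, l) = g (f (unit_vec a l)) $ k"
    using k l by (simp add: canonical_matrix_def SVect_def compose_def)
  also have "\<dots> = (canonical_matrix b c g *\<^sub>v f (unit_vec a l)) $ k"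
    by (simp only: SVect_map_eq_canonical_matrix[OF g closed])
  also have "f (unit_vec a l) = col (canonical_matrix a b f) l"
    using l closed by (intro eq_vecI) (auto simp: canonical_matrix_def)
  finally show "?L $$ (k, l) = ?R $$ (k, l)"
    using k l by (simp add: canonical_matrix_def)
qed (simp_all add: canonical_matrix_def)

text \<open>Since \<open>\<complex>\<close> to the power \<open>a\<close> is encoded by
  \<open>a\<close> and has dimension \<open>a\<close>, ranks can serve directly as objects of
  \<open>SVect\<close>.\<close>

lemma rank_matrix_entry:
  assumes "i < m" "j < n"
  shows "rank_matrix m n F $$ (i, j) = obj F (Cj j n) i"
  using assms by (simp add: rank_matrix_def dim_Cspace component_def)

text \<open>Provides the linearity that \<open>canonical_matrix_Comp\<close> requires of both
  factors.\<close>

lemma Phi_in_Hom: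
  assumes "nat_trans (SVectn n) (SVectn m) F F' \<tau>" "i < m" "j < n"
  shows "Phi n \<tau> i j \<in> Hom SVect (rank_matrix m n F $$ (i, j)) (rank_matrix m n F' $$ (i, j))"
proof -
  have "Cj j n \<in> Ob (SVectn n)"
    by (simp add: Cj_def power_cat_def SVect_def)
  then have "\<tau> (Cj j n) \<in> Hom (SVectn m) (obj F (Cj j n)) (obj F' (Cj j n))"
    using assms(1) by (simp add: nat_trans_def)
  then show ?thesis
    using assms(2,3) by (simp add: power_cat_def PiE_iff Phi_def rank_matrix_entry)
qed

lemma T_matrix_vcomp:
  assumes \<tau>: "nat_trans (SVectn n) (SVectn m) F F' \<tau>"
    and \<tau>': "nat_trans (SVectn n) (SVectn m) F' F'' \<tau>'"
    and ij: "i < m" "j < n"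
  shows "T_matrix m n F F'' (vcomp (SVectn m) F F' F'' \<tau>' \<tau>) $$ (i, j) =
    T_matrix m n F' F'' \<tau>' $$ (i, j) * T_matrix m n F F' \<tau> $$ (i, j)"
proof -
  have "Phi n (vcomp (SVectn m) F F' F'' \<tau>' \<tau>) i j =
      Comp SVect (rank_matrix m n F $$ (i, j)) (rank_matrix m n F' $$ (i, j))
        (rank_matrix m n F'' $$ (i, j)) (Phi n \<tau>' i j) (Phi n \<tau> i j)"
    using ij by (simp add: Phi_def vcomp_def power_cat_def rank_matrix_entry)
  then show ?thesis
    using ij by (simp add: T_matrix_def canonical_matrix_Comp Phi_in_Hom[OF \<tau> ij] Phi_in_Hom[OF \<tau>' ij])
qed

theorem theorem3p12:
  fixes n m i j :: nat
    and F F' F'' :: SVect_functor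
    and \<tau> \<tau>' :: SVect_trans
  assumes "n \<ge> 1" and "m \<ge> 1"
    and "linear_functor (SVectn n) (SVectn m) F"
    and "linear_functor (SVectn n) (SVectn m) F'"
    and "linear_functor (SVectn n) (SVectn m) F''"
    and "nat_trans (SVectn n) (SVectn m) F F' \<tau>"
    and "nat_trans (SVectn n) (SVectn m) F' F'' \<tau>'"
    and "i < m" and "j < n"
  shows
    "let R = rank_matrix m n F $$ (i, j);
         R' = rank_matrix m n F' $$ (i, j);
         R'' = rank_matrix m n F'' $$ (i, j);
         T = T_matrix m n F F'' (vcomp (SVectn m) F F' F'' \<tau>' \<tau>) $$ (i, j)
     in (R'' \<noteq> 0 \<and> R' \<noteq> 0 \<and> R \<noteq> 0 \<longrightarrow>
           T = T_matrix m n F' F'' \<tau>' $$ (i, j) * T_matrix m n F F' \<tau> $$ (i, j)) \<and>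
        (R = 0 \<or> R'' = 0 \<longrightarrow> empty_mat T) \<and>
        (R' = 0 \<and> R \<noteq> 0 \<and> R'' \<noteq> 0 \<longrightarrow> T = 0\<^sub>m R'' R)"
proof -
  define R R' R'' where "R = rank_matrix m n F $$ (i, j)"
    and "R' = rank_matrix m n F' $$ (i, j)" and "R'' = rank_matrix m n F'' $$ (i, j)"
  define T where "T = T_matrix m n F F'' (vcomp (SVectn m) F F' F'' \<tau>' \<tau>) $$ (i, j)"
  have T: "T \<in> carrier_mat R'' R"
    using assms(8,9) by (simp add: T_def R_def R''_def T_matrix_def canonical_matrix_def)
  have prod: "T = T_matrix m n F' F'' \<tau>' $$ (i, j) * T_matrix m n F F' \<tau> $$ (i, j)"
    unfolding T_def by (rule T_matrix_vcomp[OF assms(6-9)])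
  \<comment> \<open>Each entry of the product is a sum over \<open>R'\<close> indices, hence an
    empty sum here.\<close>
  have "T = 0\<^sub>m R'' R" if "R' = 0"
  proof (rule eq_matI)
    fix k l
    assume "k < dim_row (0\<^sub>m R'' R)" "l < dim_col (0\<^sub>m R'' R)"
    then show "T $$ (k, l) = 0\<^sub>m R'' R $$ (k, l)"
      using that assms(8,9) unfolding prod
      by (simp add: T_matrix_def canonical_matrix_def scalar_prod_def R_def R'_def R''_def)
  qed (use T in auto)
  moreover have "empty_mat T" if "R = 0 \<or> R'' = 0"
    using T that by (auto simp: empty_mat_def)
  ultimately show ?thesis
    using prod unfolding Let_def T_def R_def R'_def R''_def by blast
qed

end
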